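(* Let $\mathcal{R}:\mathbb{R}^V\to\mathbb{R}^V$ be the residual function defined in the context, with $\mathcal{H}$ satisfying (H1), (H2) and (H3) (with constant $\lambda>0$). For $j\in V$ let $$\mathcal{V}_j':=\{\,i\in\mathcal{J}:\ j\in\mathcal{V}_i\,\}.$$ Suppose that $$\lambda>\frac{[\mathcal{H}]_p}{\Delta x_{\min}}\max_{j\in\mathcal{J}}\big(\max(|\mathcal{V}_j|,|\mathcal{V}_j'|)\big)\qquad\text{and}\qquad \lambda_b>\frac{[\mathcal{H}]_p}{\Delta x_{\min}}\max_{j\in\mathcal{B}}|\mathcal{V}_j'|,$$ and set $$c_1:=\min(\lambda,\lambda_b),\qquad c_2:=\min\Big(\lambda-\tfrac{[\mathcal{H}]_p}{\Delta x_{\min}}\max_{j\in\mathcal{J}}|\mathcal{V}_j'|,\ \lambda_b-\tfrac{[\mathcal{H}]_p}{\Delta x_{\min}}\max_{j\in\mathcal{B}}|\mathcal{V}_j'|\Big)>0.$$ Let $\bar u$ be the unique solution of $\mathcal{R}(\bar u)=0$. Then the loss $L(u):=\|\mathcal{R}(u)\|_{\ell^2(V)}^2$ satisfies $$\|u-\bar u\|_{\ell^2(V)}^2\le\frac{1}{c_1c_2}L(u)\qquad\forall u\in\mathbb{R}^V,$$ together with the generalized Polyak--Łojasiewicz inequality $$\|w\|_{\ell^2(V)}^2\ge 4c_1c_2\,L(u)\qquad\forall u\in\mathbb{R}^V,\ \forall w\in\partial L(u).$$ Moreover, for any $u\in\mathbb{R}^V$ and $A\in\partial\mathcal{R}(u)$,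 the condition number of $A$ satisfies $$\kappa(A):=\|A\|_{\ell^2(V)}\|A^{-1}\|_{\ell^2(V)}\le(c_1c_2)^{-1/2}\max\{[\mathcal{H}]_u+2\lambda,\ 2\lambda_b\}.$$
   Context: Setting. $V$ is a finite index set, $\{x_j\}_{j\in V}$ are nodes which are the vertices of a directed graph; $\mathcal{V}_j\subset V$ is the set of (out-)neighbors of $j$, with $j\notin\mathcal{V}_j$. Put $\mathcal{J}:=\{j\in V:\mathcal{V}_j\neq\emptyset\}$ and $\mathcal{B}:=\{j\in V:\mathcal{V}_j=\emptyset\}$, both assumed non-empty. For $k\in\mathcal{V}_j$, $\Delta x_{jk}>0$ is the distance between $x_j$ and $x_k$; $\Delta x_{\min}:=\min_{j\in\mathcal{J},k\in\mathcal{V}_j}\Delta x_{jk}$. For $u\in\mathbb{R}^V$ and $j\in\mathcal{J}$, $\nabla_G u_j:=\{(u_j-u_k)/\Delta x_{jk}\}_{k\in\mathcal{V}_j}\in\mathbb{R}^{|\mathcal{V}_j|}$. For each $j\in\mathcal{J}$ a numerical Hamiltonian $\mathcal{H}(x_j,\cdot,\cdot):\mathbb{R}\times\mathbb{R}^{|\mathcal{V}_j|}\to\mathbb{R}$ is given. Boundary values $\{g_j\}_{j\in\mathcal{B}}$ are given. Residual: for a constant $\lambda_b>0$, $\mathcal{R}(u)_j:=\mathcal{H}(x_j,u_j,\nabla_G u_j)$ for $j\in\mathcal{J}$ and $\mathcal{R}(u)_j:=\lambda_b(u_j-g_j)$ for $j\in\mathcal{B}$. Hypotheses. (H1) There are constants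 $[\mathcal{H}]_u,[\mathcal{H}]_p>0$, independent of $x_j$, such that $|\mathcal{H}(x_j,u,p)-\mathcal{H}(x_j,v,p)|\le[\mathcal{H}]_u|u-v|$ and $|\mathcal{H}(x_j,u,p)-\mathcal{H}(x_j,u,q)|\le[\mathcal{H}]_p\|p-q\|_\infty$ for all $j\in\mathcal{J}$, $u,v\in\mathbb{R}$, $p,q\in\mathbb{R}^{|\mathcal{V}_j|}$. (H2) For all $j\in\mathcal{J}$, $u,v\in\mathbb{R}$, $p,q\in\mathbb{R}^{|\mathcal{V}_j|}$: $p\le q$ componentwise implies $\mathcal{H}(x_j,u,p)\le\mathcal{H}(x_j,u,q)$; and $u\le v$ implies $\mathcal{H}(x_j,u,p)\le\mathcal{H}(x_j,v,p)$. (H3) There is $\lambda>0$ such that for all $j\in\mathcal{J}$, $u,v\in\mathbb{R}$, $p\in\mathbb{R}^{|\mathcal{V}_j|}$: $v\ge u$ implies $\mathcal{H}(x_j,v,p)-\mathcal{H}(x_j,u,p)\ge\lambda(v-u)$. Under these hypotheses $\mathcal{R}(\bar u)=0$ has exactly one solution. Generalized differentials: $\partial\mathcal{R}(u)$ is the convex hull of all limits of Jacobian matrices $D\mathcal{R}(u_n)$ over sequences $(u_n)$ of differentiability points of $\mathcal{R}$ converging to $u$; $\partial L(u)$ (Clarke generalized gradient) is the convex hull of all limits of $\nabla L(u_n)$ over sequences of differentiability points of $L$ converging to $u$. For matrices, $\|\cdot\|_{\ell^2(V)}$ is the operator norm induced by the Euclidean norm on $\mathbb{R}^V$. *)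

theory Defs
  imports "HOL-Analysis.Analysis"
begin

text \<open>
  The vertex set is the finite type \<^typ>\<open>'v\<close>, and \<open>N j\<close> is the set of out-neighbours
  of \<open>j\<close>. The space of real vectors indexed by \<open>N j\<close> is represented by
  \<^term>\<open>extensional (N j) :: ('v \<Rightarrow> real) set\<close>, so that every such vector has exactly one
  representative. The values \<open>H j\<close> for \<open>j \<notin> interior_nodes N\<close>, \<open>g j\<close> for
  \<open>j \<notin> boundary_nodes N\<close> and \<open>dx j k\<close> for \<open>k \<notin> N j\<close> are never used.
\<close>

definition interior_nodes :: "('v \<Rightarrow> 'v set) \<Rightarrow> 'v set" where
  "interior_nodes N = {j. N j \<noteq> {}}"

definition boundary_nodes :: "('v \<Rightarrow> 'v set) \<Rightarrow> 'v set" where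
  "boundary_nodes N = {j. N j = {}}"

definition in_neighbors :: "('v \<Rightarrow> 'v set) \<Rightarrow> 'v \<Rightarrow> 'v set" where
  "in_neighbors N j = {i \<in> interior_nodes N. j \<in> N i}"

definition dx_min :: "('v::finite \<Rightarrow> 'v set) \<Rightarrow> ('v \<Rightarrow> 'v \<Rightarrow> real) \<Rightarrow> real" where
  "dx_min N dx = Min {dx j k | j k. j \<in> interior_nodes N \<and> k \<in> N j}"

definition graph_gradient ::
    "('v::finite \<Rightarrow> 'v set) \<Rightarrow> ('v \<Rightarrow> 'v \<Rightarrow> real) \<Rightarrow> real ^ 'v \<Rightarrow> 'v \<Rightarrow> ('v \<Rightarrow> real)" where
  "graph_gradient N dx u j = (\<lambda>k\<in>N j. (u $ j - u $ k) / dx j k)"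

definition residual ::
    "('v::finite \<Rightarrow> 'v set) \<Rightarrow> ('v \<Rightarrow> 'v \<Rightarrow> real) \<Rightarrow> ('v \<Rightarrow> real \<Rightarrow> ('v \<Rightarrow> real) \<Rightarrow> real)
      \<Rightarrow> ('v \<Rightarrow> real) \<Rightarrow> real \<Rightarrow> real ^ 'v \<Rightarrow> real ^ 'v" where
  "residual N dx H g lam_b u =
    (\<chi> j. if j \<in> interior_nodes N then H j (u $ j) (graph_gradient N dx u j)
          else lam_b * (u $ j - g j))"

text \<open>Only meant for non-empty finite \<open>S\<close>.\<close>

definition sup_norm_on :: "'v set \<Rightarrow> ('v \<Rightarrow> real) \<Rightarrow> real" where
  "sup_norm_on S p = (MAX k\<in>S. \<bar>p k\<bar>)"

definition hamiltonian_lipschitz ::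
    "('v::finite \<Rightarrow> 'v set) \<Rightarrow> ('v \<Rightarrow> real \<Rightarrow> ('v \<Rightarrow> real) \<Rightarrow> real) \<Rightarrow> real \<Rightarrow> real \<Rightarrow> bool" where
  "hamiltonian_lipschitz N H Hu Hp \<longleftrightarrow>
    (\<forall>j\<in>interior_nodes N. \<forall>u v. \<forall>p\<in>extensional (N j). \<forall>q\<in>extensional (N j).
      \<bar>H j u p - H j v p\<bar> \<le> Hu * \<bar>u - v\<bar> \<and>
      \<bar>H j u p - H j u q\<bar> \<le> Hp * sup_norm_on (N j) (\<lambda>k. p k - q k))"

definition hamiltonian_monotone ::
    "('v::finite \<Rightarrow> 'v set) \<Rightarrow> ('v \<Rightarrow> real \<Rightarrow> ('v \<Rightarrow> real) \<Rightarrow> real) \<Rightarrow> bool" where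
  "hamiltonian_monotone N H \<longleftrightarrow>
    (\<forall>j\<in>interior_nodes N. \<forall>u v. \<forall>p\<in>extensional (N j). \<forall>q\<in>extensional (N j).
      ((\<forall>k\<in>N j. p k \<le> q k) \<longrightarrow> H j u p \<le> H j u q) \<and>
      (u \<le> v \<longrightarrow> H j u p \<le> H j v p))"

definition hamiltonian_strictly_monotone ::
    "('v::finite \<Rightarrow> 'v set) \<Rightarrow> ('v \<Rightarrow> real \<Rightarrow> ('v \<Rightarrow> real) \<Rightarrow> real) \<Rightarrow> real \<Rightarrow> bool" where
  "hamiltonian_strictly_monotone N H lam \<longleftrightarrow>
    (\<forall>j\<in>interior_nodes N. \<forall>u v. \<forall>p\<in>extensional (N j).
      v \<ge> u \<longrightarrow> H j v p - H j u p \<ge> lam * (v - u))"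

definition generalized_jacobian :: "(real ^ 'n \<Rightarrow> real ^ 'm) \<Rightarrow> real ^ 'n \<Rightarrow> (real ^ 'n ^ 'm) set" where
  "generalized_jacobian F u = convex hull
    {A. \<exists>U. (\<forall>n. F differentiable (at (U n))) \<and> U \<longlonglongrightarrow> u \<and>
            (\<lambda>n. jacobian F (at (U n))) \<longlonglongrightarrow> A}"

definition clarke_gradient :: "('a::real_inner \<Rightarrow> real) \<Rightarrow> 'a \<Rightarrow> 'a set" where
  "clarke_gradient L u = convex hull
    {w. \<exists>U G. (\<forall>n. GDERIV L (U n) :> G n) \<and> U \<longlonglongrightarrow> u \<and> G \<longlonglongrightarrow> w}"

text \<open>Only meant for invertible \<open>A\<close>; \<^const>\<open>onorm\<close> is taken with respect to the Euclidean norm.\<close>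

definition condition_number :: "real ^ 'n ^ 'n \<Rightarrow> real" where
  "condition_number A = onorm ((*v) A) * onorm ((*v) (matrix_inv A))"

end

theory Submission
  imports Defs
begin

text \<open>
  Everything follows from two global estimates for the residual \<open>R\<close>, in which no derivative
  occurs: \<open>R\<close> is strongly monotone, \<open>(u - v) \<bullet> (R u - R v) \<ge> \<mu> \<parallel>u - v\<parallel>\<^sup>2\<close> with
  \<open>\<mu> = \<surd>(c1 * c2)\<close>, and \<open>R\<close> is Lipschitz with constant \<open>max (Hu + 2 * lam) (2 * lam_b)\<close>.

  Strong monotonicity (\<open>strongly_monotone_residual\<close>): put \<open>d = u - v\<close> and \<open>C = Hp / dx_min\<close>. At an
  interior node the zeroth order argument contributes at least \<open>lam * d\<^sub>j\<^sup>2\<close> to \<open>d\<^sub>j * (R u - R v)\<^sub>j\<close>.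
  Suppose \<open>d\<^sub>j \<ge> 0\<close>. By monotonicity in the gradient only the neighbours with \<open>d\<^sub>k > d\<^sub>j\<close> can spoil
  this, each by at most \<open>C * d\<^sub>j * (d\<^sub>k - d\<^sub>j) \<le> C / 2 * d\<^sub>k\<^sup>2\<close>; the case \<open>d\<^sub>j < 0\<close> follows by
  exchanging \<open>u\<close> and \<open>v\<close>. Summing over the edges, the node \<open>k\<close> is
  charged once for each in-neighbour, so its coefficient is at least
  \<open>l\<^sub>k - C / 2 * n\<^sub>k = (l\<^sub>k + (l\<^sub>k - C * n\<^sub>k)) / 2\<close>, where \<open>n\<^sub>k\<close> is the number of in-neighbours and
  \<open>l\<^sub>k\<close> is \<open>lam\<close> or \<open>lam_b\<close>. This is at least \<open>(c1 + c2) / 2 \<ge> \<surd>(c1 * c2)\<close>.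
  The Lipschitz bound (\<open>lipschitz_residual\<close>) is the Schur test for a nonnegative matrix that
  dominates the differences of \<open>R\<close>.

  The error bound is strong monotonicity with \<open>v\<close> the solution, and the Cauchy--Schwarz inequality.

  For the Polyak--Lojasiewicz inequality, move from \<open>u\<close> in the direction \<open>R u\<close>: strong monotonicity
  makes \<open>\<parallel>R\<parallel>\<^sup>2\<close> grow at rate at least \<open>2 * \<mu> * \<parallel>R u\<parallel>\<^sup>2\<close>, so each gradient \<open>G\<close> of \<open>\<parallel>R\<parallel>\<^sup>2\<close> at \<open>u\<close>
  satisfies \<open>R u \<bullet> G \<ge> 2 * \<mu> * \<parallel>R u\<parallel>\<^sup>2\<close>. The point of this form is that it is affine in \<open>G\<close> and
  continuous in \<open>u\<close>; it therefore passes to limits and convex hulls, which a lower bound on \<open>\<parallel>G\<parallel>\<close>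
  would not. It also avoids a chain rule for \<open>\<parallel>R\<parallel>\<^sup>2\<close>, which may be differentiable where \<open>R\<close> is not.

  Likewise, for fixed \<open>x\<close>, both estimates confine the difference quotients of \<open>R\<close> in the direction
  \<open>x\<close> to a closed convex set, hence also \<open>A *v x\<close> for every generalized Jacobian \<open>A\<close>. So
  \<open>x \<bullet> (A *v x) \<ge> \<mu> \<parallel>x\<parallel>\<^sup>2\<close>, which bounds the inverse by \<open>1 / \<mu>\<close>, and \<open>\<parallel>A *v x\<parallel> \<le> M \<parallel>x\<parallel>\<close> with
  \<open>M\<close> the Lipschitz constant.
\<close>

section \<open>Strong monotonicity\<close>

definition strongly_monotone :: "real \<Rightarrow> ('a::real_inner \<Rightarrow> 'a) \<Rightarrow> bool" where
  "strongly_monotone mu F \<longleftrightarrow> (\<forall>u v. mu * (norm (u - v))\<^sup>2 \<le> (u - v) \<bullet> (F u - F v))"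

lemma coercive_norm_le:
  fixes x y :: "'a::real_inner"
  assumes "mu * (norm x)\<^sup>2 \<le> x \<bullet> y"
  shows "mu * norm x \<le> norm y"
proof (cases "x = 0")
  case False
  have "norm x * (mu * norm x) \<le> norm x * norm y"
    using assms norm_cauchy_schwarz[of x y] by (simp add: power2_eq_square algebra_simps)
  with False show ?thesis by simp
qed simp

text \<open>
  The common route from global estimates to derivatives: a closed condition on all forward
  difference quotients in a direction is inherited by the directional derivative.
\<close>

lemma directional_derivative_in_closed:
  assumes F: "(F has_derivative F') (at u)" and K: "closed K"
    and quot: "\<And>t::real. t > 0 \<Longrightarrow> (F (u + t *\<^sub>R x) - F u) /\<^sub>R t \<in> K"
  shows "F' x \<in> K"
proof -
  have "((\<lambda>t::real. F (u + t *\<^sub>R x)) has_derivative (\<lambda>t. F' (t *\<^sub>R x))) (at 0)"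
    by (rule has_derivative_compose[where g = F and f = "\<lambda>t. u + t *\<^sub>R x"])
       (auto intro!: derivative_eq_intros F)
  then have "((\<lambda>t::real. F (u + t *\<^sub>R x)) has_vector_derivative F' x) (at 0)"
    unfolding has_vector_derivative_def
    by (simp add: linear_scale[OF has_derivative_linear[OF F]])
  then have "((\<lambda>t::real. F (u + t *\<^sub>R x)) has_vector_derivative F' x) (at_right 0)"
    by (rule has_vector_derivative_at_within)
  then have "((\<lambda>t. (1 / norm (t - 0)) *\<^sub>R (F (u + t *\<^sub>R x) - (F (u + 0 *\<^sub>R x) + (t - 0) *\<^sub>R F' x))) \<longlongrightarrow> 0) (at_right 0)"
    unfolding has_vector_derivative_def has_derivative_within by blast
  from tendsto_add[OF this tendsto_const[of "F' x"]]
  have "((\<lambda>t. (F (u + t *\<^sub>R x) - F u) /\<^sub>R t) \<longlongrightarrow> F' x) (at_right 0)"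
    by (rule Lim_transform_eventually[THEN tendsto_eq_rhs])
       (auto intro!: eventually_at_rightI[of 0 1] simp: algebra_simps divide_inverse)
  moreover have "\<forall>\<^sub>F t in at_right 0. (F (u + t *\<^sub>R x) - F u) /\<^sub>R t \<in> K"
    by (rule eventually_mono[OF eventually_at_right_less]) (rule quot)
  ultimately show ?thesis
    by (intro Lim_in_closed_set[OF K]) simp_all
qed

text \<open>
  Expanding the square, the increment of \<open>\<parallel>F\<parallel>\<^sup>2\<close> is at least twice the inner product of \<open>F u\<close> with
  the increment of \<open>F\<close>. The step is taken along \<open>F u\<close> itself, so that strong monotonicity
  bounds exactly this product.
\<close>

lemma strongly_monotone_sq_norm_increment:
  assumes F: "strongly_monotone mu F" and t: "t > 0"
  shows "2 * mu * t * (norm (F u))\<^sup>2 \<le> (norm (F (u + t *\<^sub>R F u)))\<^sup>2 - (norm (F u))\<^sup>2"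
proof -
  let ?d = "F (u + t *\<^sub>R F u) - F u"
  have "mu * (norm (t *\<^sub>R F u))\<^sup>2 \<le> (t *\<^sub>R F u) \<bullet> ?d"
    using F[unfolded strongly_monotone_def, rule_format, of "u + t *\<^sub>R F u" u] by simp
  then have "t * (mu * t * (norm (F u))\<^sup>2) \<le> t * (F u \<bullet> ?d)"
    using t by (simp add: power_mult_distrib power2_eq_square mult_ac)
  then have "mu * t * (norm (F u))\<^sup>2 \<le> F u \<bullet> ?d"
    using t by simp
  moreover have "(norm (F (u + t *\<^sub>R F u)))\<^sup>2 - (norm (F u))\<^sup>2 = 2 * (F u \<bullet> ?d) + ?d \<bullet> ?d"
    by (simp add: power2_norm_eq_inner inner_diff inner_commute)
  ultimately show ?thesis
    using inner_ge_zero[of ?d] by linarith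
qed

lemma strongly_monotone_gradient_sq_norm:
  assumes F: "strongly_monotone mu F"
    and G: "GDERIV (\<lambda>v. (norm (F v))\<^sup>2) u :> G"
  shows "2 * mu * (norm (F u))\<^sup>2 \<le> F u \<bullet> G"
proof -
  have "F u \<bullet> G \<in> {2 * mu * (norm (F u))\<^sup>2 ..}"
  proof (rule directional_derivative_in_closed[OF G[unfolded gderiv_def]])
    fix t :: real assume t: "t > 0"
    show "((norm (F (u + t *\<^sub>R F u)))\<^sup>2 - (norm (F u))\<^sup>2) /\<^sub>R t \<in> {2 * mu * (norm (F u))\<^sup>2 ..}"
      using strongly_monotone_sq_norm_increment[OF F t, of u] t
      by (simp add: field_simps)
  qed simp
  then show ?thesis by simp
qed

text \<open>
  For fixed \<open>u\<close> the conclusion describes a half-space of vectors \<open>w\<close>, which is convex; so only limits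
  of gradients matter, and for these the inequality at the approximating points passes to the limit.
\<close>

lemma strongly_monotone_clarke_gradient_sq_norm:
  assumes F: "strongly_monotone mu F" and cont: "continuous_on UNIV F"
    and w: "w \<in> clarke_gradient (\<lambda>v. (norm (F v))\<^sup>2) u"
  shows "2 * mu * (norm (F u))\<^sup>2 \<le> F u \<bullet> w"
proof -
  have "clarke_gradient (\<lambda>v. (norm (F v))\<^sup>2) u \<subseteq> {w. F u \<bullet> w \<ge> 2 * mu * (norm (F u))\<^sup>2}"
    unfolding clarke_gradient_def
  proof (rule hull_minimal)
    show "convex {w. F u \<bullet> w \<ge> 2 * mu * (norm (F u))\<^sup>2}"
      by (rule convex_halfspace_ge)
    show "{w. \<exists>U G. (\<forall>n. GDERIV (\<lambda>v. (norm (F v))\<^sup>2) (U n) :> G n) \<and> U \<longlonglongrightarrow> u \<and> G \<longlonglongrightarrow> w}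
        \<subseteq> {w. F u \<bullet> w \<ge> 2 * mu * (norm (F u))\<^sup>2}"
    proof clarify
      fix l U G
      assume G: "\<forall>n. GDERIV (\<lambda>v. (norm (F v))\<^sup>2) (U n) :> G n"
        and U: "U \<longlonglongrightarrow> u" and l: "G \<longlonglongrightarrow> l"
      have FU: "(\<lambda>n. F (U n)) \<longlonglongrightarrow> F u"
        using cont U by (simp add: continuous_on_tendsto_compose)
      show "2 * mu * (norm (F u))\<^sup>2 \<le> F u \<bullet> l"
      proof (rule LIMSEQ_le)
        show "(\<lambda>n. 2 * mu * (norm (F (U n)))\<^sup>2) \<longlonglongrightarrow> 2 * mu * (norm (F u))\<^sup>2"
          by (intro tendsto_intros FU)
        show "(\<lambda>n. F (U n) \<bullet> G n) \<longlonglongrightarrow> F u \<bullet> l"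
          by (intro tendsto_intros FU l)
        show "\<exists>m. \<forall>n\<ge>m. 2 * mu * (norm (F (U n)))\<^sup>2 \<le> F (U n) \<bullet> G n"
          using strongly_monotone_gradient_sq_norm[OF F] G by blast
      qed
    qed
  qed
  with w show ?thesis by blast
qed

section \<open>Generalized Jacobians\<close>

text \<open>
  The direction \<open>x\<close> is fixed because \<open>A \<mapsto> A *v x\<close> is linear: the preimage of \<open>K\<close> is again closed and
  convex, hence stable under the limits and the convex hull in the definition.
\<close>

lemma generalized_jacobian_in_closed_convex:
  fixes F :: "real ^ 'n \<Rightarrow> real ^ 'm"
  assumes A: "A \<in> generalized_jacobian F u" and K: "closed K" "convex K"
    and quot: "\<And>v t. t > 0 \<Longrightarrow> (F (v + t *\<^sub>R x) - F v) /\<^sub>R t \<in> K"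
  shows "A *v x \<in> K"
proof -
  have lin: "linear (\<lambda>A :: real ^ 'n ^ 'm. A *v x)"
    by (rule linearI) (simp_all add: matrix_vector_mult_add_rdistrib scaleR_matrix_vector_assoc)
  have "generalized_jacobian F u \<subseteq> (\<lambda>A. A *v x) -` K"
    unfolding generalized_jacobian_def
  proof (rule hull_minimal)
    show "convex ((\<lambda>A. A *v x) -` K)"
      by (rule convex_linear_vimage[OF lin K(2)])
    show "{A. \<exists>U. (\<forall>n. F differentiable (at (U n))) \<and> U \<longlonglongrightarrow> u \<and>
            (\<lambda>n. jacobian F (at (U n))) \<longlonglongrightarrow> A} \<subseteq> (\<lambda>A. A *v x) -` K"
    proof clarify
      fix B U
      assume diff: "\<forall>n. F differentiable (at (U n))"
        and B: "(\<lambda>n. jacobian F (at (U n))) \<longlonglongrightarrow> B"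
      have "jacobian F (at (U n)) *v x \<in> K" for n
        using directional_derivative_in_closed[OF _ K(1) quot] diff jacobian_works by blast
      moreover have "(\<lambda>n. jacobian F (at (U n)) *v x) \<longlonglongrightarrow> B *v x"
        by (rule bounded_linear.tendsto[OF lin[unfolded linear_conv_bounded_linear] B])
      ultimately show "B \<in> (\<lambda>A. A *v x) -` K"
        unfolding vimage_eq using closed_sequentially[OF K(1), of "\<lambda>n. jacobian F (at (U n)) *v x" "B *v x"] by blast
    qed
  qed
  with A show ?thesis by blast
qed

lemma strongly_monotone_generalized_jacobian:
  fixes F :: "real ^ 'n \<Rightarrow> real ^ 'n"
  assumes F: "strongly_monotone mu F" and A: "A \<in> generalized_jacobian F u"
  shows "mu * (norm x)\<^sup>2 \<le> x \<bullet> (A *v x)"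
proof -
  have "A *v x \<in> {y. x \<bullet> y \<ge> mu * (norm x)\<^sup>2}"
  proof (rule generalized_jacobian_in_closed_convex[OF A closed_halfspace_ge convex_halfspace_ge])
    fix v :: "real ^ 'n" and t :: real assume t: "t > 0"
    have "t * (t * (mu * (norm x)\<^sup>2)) \<le> t * (x \<bullet> (F (v + t *\<^sub>R x) - F v))"
      using F[unfolded strongly_monotone_def, rule_format, of "v + t *\<^sub>R x" v]
      by (simp add: power_mult_distrib power2_eq_square mult_ac)
    then have "t * (mu * (norm x)\<^sup>2) \<le> x \<bullet> (F (v + t *\<^sub>R x) - F v)"
      using t by simp
    then have "mu * (norm x)\<^sup>2 \<le> x \<bullet> (F (v + t *\<^sub>R x) - F v) / t"
      using t by (simp add: pos_le_divide_eq mult.commute)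
    then show "(F (v + t *\<^sub>R x) - F v) /\<^sub>R t \<in> {y. x \<bullet> y \<ge> mu * (norm x)\<^sup>2}"
      by (simp add: divide_inverse mult.commute)
  qed
  then show ?thesis by simp
qed

lemma lipschitz_generalized_jacobian:
  fixes F :: "real ^ 'n \<Rightarrow> real ^ 'm"
  assumes F: "\<And>u v. norm (F u - F v) \<le> M * norm (u - v)"
    and A: "A \<in> generalized_jacobian F u"
  shows "norm (A *v x) \<le> M * norm x"
proof -
  have "A *v x \<in> cball 0 (M * norm x)"
  proof (rule generalized_jacobian_in_closed_convex[OF A closed_cball convex_cball])
    fix v :: "real ^ 'n" and t :: real assume t: "t > 0"
    have "norm (F (v + t *\<^sub>R x) - F v) \<le> M * (t * norm x)"
      using F[of "v + t *\<^sub>R x" v] t by simp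
    then have "norm (F (v + t *\<^sub>R x) - F v) / t \<le> M * norm x"
      using t by (simp add: pos_divide_le_eq mult_ac)
    then show "(F (v + t *\<^sub>R x) - F v) /\<^sub>R t \<in> cball 0 (M * norm x)"
      using t by (simp add: divide_inverse_commute)
  qed
  then show ?thesis by simp
qed

lemma condition_number_coercive_le:
  fixes A :: "real ^ 'n ^ 'n"
  assumes mu: "mu > 0" and coercive: "\<And>x. mu * (norm x)\<^sup>2 \<le> x \<bullet> (A *v x)"
    and bound: "\<And>x. norm (A *v x) \<le> M * norm x"
  shows "invertible A" and "condition_number A \<le> M / mu"
proof -
  have below: "mu * norm x \<le> norm (A *v x)" for x
    by (rule coercive_norm_le[OF coercive])
  have "A *v x = 0 \<Longrightarrow> x = 0" for x
    using below[of x] mu by (simp add: mult_le_0_iff)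
  then show inv: "invertible A"
    using invertible_left_inverse matrix_left_invertible_ker by blast
  have "norm (matrix_inv A *v y) \<le> (1 / mu) * norm y" for y
  proof -
    have "A ** matrix_inv A = mat 1 \<and> matrix_inv A ** A = mat 1"
      using inv unfolding invertible_def matrix_inv_def by (rule someI_ex)
    then have "A *v (matrix_inv A *v y) = y"
      by (simp add: matrix_vector_mul_assoc)
    then show ?thesis
      using below[of "matrix_inv A *v y"] mu by (simp add: field_simps)
  qed
  then have "onorm ((*v) (matrix_inv A)) \<le> 1 / mu"
    by (intro onorm_bound) (use mu in auto)
  moreover have "onorm ((*v) A) \<le> M"
    by (rule onorm_le) (rule bound)
  ultimately show "condition_number A \<le> M / mu"
    unfolding condition_number_def
    using mult_mono[of "onorm ((*v) A)" M "onorm ((*v) (matrix_inv A))" "1 / mu"]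
      onorm_pos_le[of "(*v) A"] onorm_pos_le[of "(*v) (matrix_inv A)"] by simp
qed

section \<open>Sums over the edges of the graph\<close>

text \<open>
  Double counting: the term of \<open>k\<close> occurs once for every edge that ends in \<open>k\<close>.
\<close>

lemma sum_over_edges:
  fixes f :: "'v::finite \<Rightarrow> real"
  shows "(\<Sum>j\<in>UNIV. \<Sum>k\<in>N j. f k) = (\<Sum>k\<in>UNIV. real (card (in_neighbors N k)) * f k)"
proof -
  have "in_neighbors N k = {j. k \<in> N j}" for k
    by (auto simp: in_neighbors_def interior_nodes_def)
  moreover have "(\<Sum>j\<in>UNIV. \<Sum>k\<in>N j. f k) = (\<Sum>k\<in>UNIV. \<Sum>j\<in>{j. k \<in> N j}. f k)"
    using sum.swap_restrict[of UNIV UNIV "\<lambda>j k. f k" "\<lambda>j k. k \<in> N j"] by simp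
  ultimately show ?thesis by simp
qed

text \<open>
  The nonnegative matrix with diagonal \<open>a\<close> and entry \<open>C\<close> on each edge has row and column sums at
  most \<open>M\<close>, so its Euclidean operator norm is at most \<open>M\<close>. The proof estimates \<open>y \<bullet> y\<close> by products
  \<open>\<bar>y\<^sub>j\<bar> * \<bar>x\<^sub>k\<bar> \<le> (y\<^sub>j\<^sup>2 / M + M * x\<^sub>k\<^sup>2) / 2\<close>: the row sums control the first part, the column sums
  the second, and the weight \<open>M\<close> turns the first part into half of \<open>\<parallel>y\<parallel>\<^sup>2\<close>, which is absorbed.
\<close>

lemma schur_test_graph:
  fixes x y :: "real ^ 'v::finite" and N :: "'v \<Rightarrow> 'v set"
  assumes M: "M > 0" and C: "C \<ge> 0" and a: "\<And>j. a j \<ge> 0"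
    and y: "\<And>j. \<bar>y $ j\<bar> \<le> a j * \<bar>x $ j\<bar> + C * (\<Sum>k\<in>N j. \<bar>x $ k\<bar>)"
    and rows: "\<And>j. a j + C * real (card (N j)) \<le> M"
    and columns: "\<And>j. a j + C * real (card (in_neighbors N j)) \<le> M"
  shows "norm y \<le> M * norm x"
proof -
  define p where "p j = (y $ j)\<^sup>2 / M" for j
  define q where "q j = M * (x $ j)\<^sup>2" for j
  have pq0: "p j \<ge> 0" "q j \<ge> 0" for j
    using M by (simp_all add: p_def q_def)
  have am_gm: "\<bar>y $ j\<bar> * \<bar>x $ k\<bar> \<le> (p j + q k) / 2" for j k
  proof -
    have "0 \<le> (\<bar>y $ j\<bar> - M * \<bar>x $ k\<bar>)\<^sup>2" by simp
    then show ?thesis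
      using M by (simp add: p_def q_def field_simps power2_eq_square abs_mult_self_eq)
  qed
  have row: "(y $ j)\<^sup>2 \<le> p j * M / 2 + (a j * q j + C * (\<Sum>k\<in>N j. q k)) / 2" for j
  proof -
    have "(y $ j)\<^sup>2 = \<bar>y $ j\<bar> * \<bar>y $ j\<bar>"
      by (simp add: power2_eq_square)
    also have "\<dots> \<le> \<bar>y $ j\<bar> * (a j * \<bar>x $ j\<bar> + C * (\<Sum>k\<in>N j. \<bar>x $ k\<bar>))"
      by (rule mult_left_mono[OF y]) simp
    also have "\<dots> = a j * (\<bar>y $ j\<bar> * \<bar>x $ j\<bar>) + C * (\<Sum>k\<in>N j. \<bar>y $ j\<bar> * \<bar>x $ k\<bar>)"
      by (simp add: algebra_simps sum_distrib_left)
    also have "\<dots> \<le> a j * ((p j + q j) / 2) + C * (\<Sum>k\<in>N j. (p j + q k) / 2)"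
      by (intro add_mono mult_left_mono sum_mono am_gm a C)
    also have "\<dots> = p j * (a j + C * real (card (N j))) / 2 + (a j * q j + C * (\<Sum>k\<in>N j. q k)) / 2"
      by (simp add: sum.distrib flip: sum_divide_distrib) (simp add: field_simps)
    also have "\<dots> \<le> p j * M / 2 + (a j * q j + C * (\<Sum>k\<in>N j. q k)) / 2"
      using mult_left_mono[OF rows pq0(1), of j j] by simp
    finally show ?thesis .
  qed
  have norm_y: "(norm y)\<^sup>2 = (\<Sum>j\<in>UNIV. (y $ j)\<^sup>2)" and norm_x: "(norm x)\<^sup>2 = (\<Sum>j\<in>UNIV. (x $ j)\<^sup>2)"
    by (simp_all add: norm_vec_def L2_set_def sum_nonneg)
  have "(norm y)\<^sup>2 \<le> (\<Sum>j\<in>UNIV. p j * M / 2 + (a j * q j + C * (\<Sum>k\<in>N j. q k)) / 2)"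
    unfolding norm_y by (rule sum_mono[OF row])
  also have "\<dots> = (norm y)\<^sup>2 / 2 + (\<Sum>j\<in>UNIV. (a j + C * real (card (in_neighbors N j))) * q j) / 2"
    using M sum_over_edges[of q N]
    by (simp add: norm_y p_def sum.distrib sum_divide_distrib[symmetric] sum_distrib_left[symmetric]
        algebra_simps add_divide_distrib)
  also have "\<dots> \<le> (norm y)\<^sup>2 / 2 + (\<Sum>j\<in>UNIV. M * q j) / 2"
    by (intro add_mono divide_right_mono sum_mono mult_right_mono columns pq0) simp_all
  also have "\<dots> = (norm y)\<^sup>2 / 2 + (M * norm x)\<^sup>2 / 2"
    unfolding power_mult_distrib norm_x
    by (simp add: q_def power2_eq_square sum_distrib_left mult.assoc)
  finally have "(norm y)\<^sup>2 \<le> (M * norm x)\<^sup>2" by simp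
  then show ?thesis
    using M by (simp add: power2_le_iff_abs_le)
qed

section \<open>The residual\<close>

lemma sup_norm_on_le_sum:
  fixes S :: "'v::finite set"
  assumes "S \<noteq> {}" and "\<And>k. k \<in> S \<Longrightarrow> \<bar>p k\<bar> \<le> b k" and "\<And>k. k \<in> S \<Longrightarrow> 0 \<le> b k"
  shows "sup_norm_on S p \<le> (\<Sum>k\<in>S. b k)"
proof -
  have "\<bar>p k\<bar> \<le> (\<Sum>k\<in>S. b k)" if "k \<in> S" for k
    using assms(2)[OF that] member_le_sum[OF that, of b] assms(3) by fastforce
  then show ?thesis
    using assms(1) by (simp add: sup_norm_on_def)
qed

text \<open>
  A one-sided Lipschitz estimate that sees only the positive part of \<open>q - p\<close>: \<open>H\<close> at \<open>q\<close> is at most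
  \<open>H\<close> at the componentwise maximum of \<open>p\<close> and \<open>q\<close>, whose distance to \<open>p\<close> is that positive part.
\<close>

lemma hamiltonian_diff_le_positive_part:
  fixes N :: "'v::finite \<Rightarrow> 'v set"
  assumes H1: "hamiltonian_lipschitz N H Hu Hp" and H2: "hamiltonian_monotone N H"
    and Hp: "Hp \<ge> 0" and j: "j \<in> interior_nodes N"
    and p: "p \<in> extensional (N j)" and q: "q \<in> extensional (N j)"
  shows "H j s q - H j s p \<le> Hp * (\<Sum>k\<in>N j. max 0 (q k - p k))"
proof -
  define r where "r = (\<lambda>k\<in>N j. max (p k) (q k))"
  have r: "r \<in> extensional (N j)" by (simp add: r_def)
  have "H j s q \<le> H j s r"
    using H2 j q r unfolding hamiltonian_monotone_def by (simp add: r_def)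
  moreover have "H j s r - H j s p \<le> Hp * sup_norm_on (N j) (\<lambda>k. r k - p k)"
    using H1 j p r unfolding hamiltonian_lipschitz_def by (meson abs_le_D1)
  moreover have "sup_norm_on (N j) (\<lambda>k. r k - p k) \<le> (\<Sum>k\<in>N j. max 0 (q k - p k))"
    using j by (intro sup_norm_on_le_sum) (auto simp: interior_nodes_def r_def)
  then have "Hp * sup_norm_on (N j) (\<lambda>k. r k - p k) \<le> Hp * (\<Sum>k\<in>N j. max 0 (q k - p k))"
    using Hp by (rule mult_left_mono)
  ultimately show ?thesis by linarith
qed

lemma graph_gradient_extensional [simp]: "graph_gradient N dx u j \<in> extensional (N j)"
  by (simp add: graph_gradient_def)

lemma graph_gradient_diff:
  assumes "k \<in> N j"
  shows "graph_gradient N dx u j k - graph_gradient N dx v j k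
    = ((u - v) $ j - (u - v) $ k) / dx j k"
  using assms by (simp add: graph_gradient_def diff_divide_distrib)

text \<open>
  The value of \<open>H\<close> is changed first in the zeroth order argument and then in the gradient. The loss in
  the second step is charged to the neighbours alone, with no multiple of the square at \<open>j\<close>; this
  is what makes the out-degree disappear from the constant of strong monotonicity.
\<close>

lemma residual_interior_lower_bound:
  fixes N :: "'v::finite \<Rightarrow> 'v set"
  assumes dx_pos: "\<And>j k. k \<in> N j \<Longrightarrow> dx j k > 0"
    and H1: "hamiltonian_lipschitz N H Hu Hp" and H2: "hamiltonian_monotone N H"
    and H3: "hamiltonian_strictly_monotone N H lam"
    and Hp: "Hp \<ge> 0" and C: "\<And>j k. k \<in> N j \<Longrightarrow> Hp / dx j k \<le> C"
    and j: "j \<in> interior_nodes N"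
  shows "lam * ((u - v) $ j)\<^sup>2 - C / 2 * (\<Sum>k\<in>N j. ((u - v) $ k)\<^sup>2)
    \<le> (u - v) $ j * (residual N dx H g lam_b u - residual N dx H g lam_b v) $ j"
    (is "?ineq u v")
proof -
  have ordered: "?ineq u v" if le: "v $ j \<le> u $ j" for u v
  proof -
    define d where "d = u - v"
    define P where "P w = graph_gradient N dx w j" for w
    have d0: "d $ j \<ge> 0" using le by (simp add: d_def)
    have strict: "lam * d $ j \<le> H j (u $ j) (P u) - H j (v $ j) (P u)"
      using H3 j le unfolding hamiltonian_strictly_monotone_def by (simp add: d_def P_def)
    have lower: "H j (v $ j) (P v) - H j (v $ j) (P u) \<le> Hp * (\<Sum>k\<in>N j. max 0 (P v k - P u k))"
      by (rule hamiltonian_diff_le_positive_part[OF H1 H2 Hp j]) (simp_all add: P_def)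
    have edge: "d $ j * (Hp * max 0 (P v k - P u k)) \<le> C / 2 * (d $ k)\<^sup>2" if k: "k \<in> N j" for k
    proof -
      have P: "P v k - P u k = (d $ k - d $ j) / dx j k"
        using graph_gradient_diff[of k N j dx v u, OF k] by (simp add: P_def d_def)
      have C0: "0 \<le> Hp / dx j k" using Hp dx_pos[OF k] by simp
      have max0: "max 0 (P v k - P u k) = max 0 (d $ k - d $ j) / dx j k"
        unfolding P using dx_pos[OF k] by (simp add: max_def divide_le_0_iff zero_le_divide_iff)
      \<comment> \<open>Only neighbours with \<open>d $ k > d $ j\<close> count, and the square that is left over is dropped.\<close>
      have sq: "d $ j * max 0 (d $ k - d $ j) \<le> (d $ k)\<^sup>2 / 2"
      proof (cases "d $ k \<le> d $ j")
        case False
        have "0 \<le> (d $ k - d $ j)\<^sup>2 + (d $ j)\<^sup>2" by simp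
        then have "d $ j * (d $ k - d $ j) \<le> (d $ k)\<^sup>2 / 2"
          by (simp add: power2_eq_square algebra_simps)
        with False show ?thesis by simp
      qed simp
      have "d $ j * (Hp * max 0 (P v k - P u k)) = (Hp / dx j k) * (d $ j * max 0 (d $ k - d $ j))"
        unfolding max0 by simp
      also have "\<dots> \<le> (Hp / dx j k) * ((d $ k)\<^sup>2 / 2)"
        by (rule mult_left_mono[OF sq C0])
      also have "\<dots> \<le> C * ((d $ k)\<^sup>2 / 2)"
        by (rule mult_right_mono[OF C[OF k]]) simp
      finally show ?thesis by simp
    qed
    have "d $ j * (Hp * (\<Sum>k\<in>N j. max 0 (P v k - P u k))) \<le> C / 2 * (\<Sum>k\<in>N j. (d $ k)\<^sup>2)"
      using sum_mono[of "N j", OF edge] by (simp add: sum_distrib_left)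
    moreover have "d $ j * (lam * d $ j - Hp * (\<Sum>k\<in>N j. max 0 (P v k - P u k)))
        \<le> d $ j * (H j (u $ j) (P u) - H j (v $ j) (P v))"
      using strict lower d0 by (intro mult_left_mono) linarith+
    ultimately show "?ineq u v"
      using j by (simp add: residual_def P_def d_def power2_eq_square algebra_simps)
  qed
  have "?ineq v u \<Longrightarrow> ?ineq u v"
    by (simp add: power2_commute[of "v $ _"] algebra_simps)
  then show ?thesis
    using ordered by (meson linear)
qed

lemma strongly_monotone_residual:
  fixes N :: "'v::finite \<Rightarrow> 'v set"
  assumes dx_pos: "\<And>j k. k \<in> N j \<Longrightarrow> dx j k > 0"
    and H1: "hamiltonian_lipschitz N H Hu Hp" and H2: "hamiltonian_monotone N H"
    and H3: "hamiltonian_strictly_monotone N H lam"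
    and Hp: "Hp \<ge> 0" and C: "\<And>j k. k \<in> N j \<Longrightarrow> Hp / dx j k \<le> C"
    and mu: "\<And>j. mu \<le> (if j \<in> interior_nodes N then lam else lam_b)
                       - C / 2 * real (card (in_neighbors N j))"
  shows "strongly_monotone mu (residual N dx H g lam_b)"
  unfolding strongly_monotone_def
proof (intro allI)
  fix u v :: "real ^ 'v"
  define d where "d = u - v"
  define l where "l j = (if j \<in> interior_nodes N then lam else lam_b)" for j
  let ?R = "residual N dx H g lam_b"
  have row: "l j * (d $ j)\<^sup>2 - C / 2 * (\<Sum>k\<in>N j. (d $ k)\<^sup>2) \<le> d $ j * (?R u - ?R v) $ j" for j
  proof (cases "j \<in> interior_nodes N")
    case True
    then show ?thesis
      using residual_interior_lower_bound[OF dx_pos H1 H2 H3 Hp C True] by (simp add: l_def d_def)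
  next
    case False
    then have "N j = {}" by (simp add: interior_nodes_def)
    with False show ?thesis
      by (simp add: l_def d_def residual_def power2_eq_square algebra_simps)
  qed
  have "mu * (norm d)\<^sup>2 = (\<Sum>j\<in>UNIV. mu * (d $ j)\<^sup>2)"
    by (simp add: norm_vec_def L2_set_def sum_nonneg sum_distrib_left)
  also have "\<dots> \<le> (\<Sum>j\<in>UNIV. (l j - C / 2 * real (card (in_neighbors N j))) * (d $ j)\<^sup>2)"
    using mu by (intro sum_mono mult_right_mono) (simp_all add: l_def)
  also have "\<dots> = (\<Sum>j\<in>UNIV. l j * (d $ j)\<^sup>2) - C / 2 * (\<Sum>j\<in>UNIV. \<Sum>k\<in>N j. (d $ k)\<^sup>2)"
    unfolding sum_over_edges by (simp add: sum_subtractf sum_distrib_left left_diff_distrib mult.assoc)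
  also have "\<dots> = (\<Sum>j\<in>UNIV. l j * (d $ j)\<^sup>2 - C / 2 * (\<Sum>k\<in>N j. (d $ k)\<^sup>2))"
    by (simp add: sum_subtractf sum_distrib_left)
  also have "\<dots> \<le> (\<Sum>j\<in>UNIV. d $ j * (?R u - ?R v) $ j)"
    by (rule sum_mono[OF row])
  also have "\<dots> = d \<bullet> (?R u - ?R v)"
    by (simp add: inner_vec_def)
  finally show "mu * (norm (u - v))\<^sup>2 \<le> (u - v) \<bullet> (?R u - ?R v)"
    by (simp add: d_def)
qed

text \<open>
  Row \<open>j\<close> of the matrix for the Schur test. The sup norm of the gradient difference is replaced by
  the sum over the neighbours, to which \<open>schur_test_graph\<close> applies.
\<close>

lemma residual_interior_abs_diff_le:
  fixes N :: "'v::finite \<Rightarrow> 'v set"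
  assumes dx_pos: "\<And>j k. k \<in> N j \<Longrightarrow> dx j k > 0"
    and H1: "hamiltonian_lipschitz N H Hu Hp"
    and Hp: "Hp \<ge> 0" and C: "\<And>j k. k \<in> N j \<Longrightarrow> Hp / dx j k \<le> C"
    and j: "j \<in> interior_nodes N"
  shows "\<bar>(residual N dx H g lam_b u - residual N dx H g lam_b v) $ j\<bar>
    \<le> (Hu + C * real (card (N j))) * \<bar>(u - v) $ j\<bar> + C * (\<Sum>k\<in>N j. \<bar>(u - v) $ k\<bar>)"
proof -
  define d where "d = u - v"
  define P where "P w = graph_gradient N dx w j" for w
  have "\<bar>H j (u $ j) (P u) - H j (v $ j) (P u)\<bar> \<le> Hu * \<bar>d $ j\<bar>"
    using H1 j unfolding hamiltonian_lipschitz_def P_def d_def vector_minus_component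
    by (blast intro: graph_gradient_extensional)
  moreover have "\<bar>H j (v $ j) (P u) - H j (v $ j) (P v)\<bar>
      \<le> Hp * sup_norm_on (N j) (\<lambda>k. P u k - P v k)"
    using H1 j unfolding hamiltonian_lipschitz_def by (simp add: P_def)
  moreover have "Hp * sup_norm_on (N j) (\<lambda>k. P u k - P v k)
      \<le> Hp * (\<Sum>k\<in>N j. \<bar>P u k - P v k\<bar>)"
    using j Hp by (intro mult_left_mono sup_norm_on_le_sum) (auto simp: interior_nodes_def)
  moreover have "Hp * (\<Sum>k\<in>N j. \<bar>P u k - P v k\<bar>) \<le> (\<Sum>k\<in>N j. C * (\<bar>d $ j\<bar> + \<bar>d $ k\<bar>))"
    unfolding sum_distrib_left
  proof (rule sum_mono)
    fix k assume k: "k \<in> N j"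
    have "Hp * \<bar>P u k - P v k\<bar> = (Hp / dx j k) * \<bar>d $ j - d $ k\<bar>"
      using graph_gradient_diff[of k N j dx u v, OF k] dx_pos[OF k]
      by (simp add: P_def d_def)
    also have "\<dots> \<le> C * (\<bar>d $ j\<bar> + \<bar>d $ k\<bar>)"
      using C[OF k] Hp dx_pos[OF k] by (intro mult_mono) (auto intro: order_trans[rotated])
    finally show "Hp * \<bar>P u k - P v k\<bar> \<le> C * (\<bar>d $ j\<bar> + \<bar>d $ k\<bar>)" .
  qed
  moreover have "(\<Sum>k\<in>N j. C * (\<bar>d $ j\<bar> + \<bar>d $ k\<bar>))
      = C * real (card (N j)) * \<bar>d $ j\<bar> + C * (\<Sum>k\<in>N j. \<bar>d $ k\<bar>)"
    by (simp add: sum_distrib_left[symmetric] sum.distrib algebra_simps)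
  ultimately have "\<bar>H j (u $ j) (P u) - H j (v $ j) (P v)\<bar>
      \<le> (Hu + C * real (card (N j))) * \<bar>d $ j\<bar> + C * (\<Sum>k\<in>N j. \<bar>d $ k\<bar>)"
    unfolding distrib_right by linarith
  then show ?thesis
    using j by (simp add: residual_def P_def d_def)
qed

text \<open>
  In each row of the dominating matrix the diagonal entry is at most \<open>Hu + lam\<close>, or equal to \<open>lam_b\<close>
  at a boundary node. The remaining entries of a row or a column add at most another \<open>lam\<close> or \<open>lam_b\<close>.
\<close>

lemma lipschitz_residual:
  fixes N :: "'v::finite \<Rightarrow> 'v set"
  assumes dx_pos: "\<And>j k. k \<in> N j \<Longrightarrow> dx j k > 0"
    and H1: "hamiltonian_lipschitz N H Hu Hp"
    and Hu: "Hu \<ge> 0" and Hp: "Hp \<ge> 0"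
    and C: "\<And>j k. k \<in> N j \<Longrightarrow> Hp / dx j k \<le> C" and C0: "C \<ge> 0"
    and lam: "\<And>j. j \<in> interior_nodes N \<Longrightarrow>
          C * real (card (N j)) \<le> lam \<and> C * real (card (in_neighbors N j)) \<le> lam"
    and lam_b: "\<And>j. j \<in> boundary_nodes N \<Longrightarrow> C * real (card (in_neighbors N j)) \<le> lam_b"
    and lam_b0: "lam_b > 0"
  shows "norm (residual N dx H g lam_b u - residual N dx H g lam_b v)
    \<le> max (Hu + 2 * lam) (2 * lam_b) * norm (u - v)"
proof (rule schur_test_graph[where C = C and N = N
      and a = "\<lambda>j. if j \<in> interior_nodes N then Hu + C * real (card (N j)) else lam_b"])
  show "max (Hu + 2 * lam) (2 * lam_b) > 0" using lam_b0 by simp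
  show "C \<ge> 0" by (rule C0)
  fix j
  let ?a = "if j \<in> interior_nodes N then Hu + C * real (card (N j)) else lam_b"
  show "?a \<ge> 0" using Hu C0 lam_b0 by simp
  show "?a + C * real (card (N j)) \<le> max (Hu + 2 * lam) (2 * lam_b)"
  proof (cases "j \<in> interior_nodes N")
    case True
    then have "?a + C * real (card (N j)) \<le> Hu + 2 * lam" using lam[of j] by simp
    then show ?thesis by simp
  qed (use lam_b0 in \<open>simp add: interior_nodes_def\<close>)
  show "?a + C * real (card (in_neighbors N j)) \<le> max (Hu + 2 * lam) (2 * lam_b)"
  proof (cases "j \<in> interior_nodes N")
    case True
    then have "?a + C * real (card (in_neighbors N j)) \<le> Hu + 2 * lam" using lam[of j] by simp
    then show ?thesis by simp
  next
    case False
    then have "?a + C * real (card (in_neighbors N j)) \<le> 2 * lam_b"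
      using lam_b[of j] by (simp add: interior_nodes_def boundary_nodes_def)
    then show ?thesis by simp
  qed
  show "\<bar>(residual N dx H g lam_b u - residual N dx H g lam_b v) $ j\<bar>
      \<le> ?a * \<bar>(u - v) $ j\<bar> + C * (\<Sum>k\<in>N j. \<bar>(u - v) $ k\<bar>)"
  proof (cases "j \<in> interior_nodes N")
    case True
    then show ?thesis
      using residual_interior_abs_diff_le[OF dx_pos H1 Hp C True] by simp
  next
    case False
    then have "N j = {}" by (simp add: interior_nodes_def)
    moreover have "(residual N dx H g lam_b u - residual N dx H g lam_b v) $ j = lam_b * (u - v) $ j"
      using False by (simp add: residual_def algebra_simps)
    ultimately show ?thesis
      using False lam_b0 by (simp add: abs_mult)
  qed
qed

lemma dx_min_pos_le:
  fixes N :: "'v::finite \<Rightarrow> 'v set"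
  assumes ne: "interior_nodes N \<noteq> {}" and dx_pos: "\<And>j k. k \<in> N j \<Longrightarrow> dx j k > 0"
  shows "dx_min N dx > 0" and "k \<in> N j \<Longrightarrow> dx_min N dx \<le> dx j k"
proof -
  let ?S = "{dx j k | j k. j \<in> interior_nodes N \<and> k \<in> N j}"
  have fin: "finite ?S"
    by (rule finite_subset[of _ "case_prod dx ` UNIV"]) auto
  obtain j k where "k \<in> N j" "j \<in> interior_nodes N"
    using ne unfolding interior_nodes_def by blast
  then have "?S \<noteq> {}" by blast
  then have "dx_min N dx \<in> ?S"
    unfolding dx_min_def by (rule Min_in[OF fin])
  then show "dx_min N dx > 0" using dx_pos by auto
  show "dx_min N dx \<le> dx j k" if "k \<in> N j" for j k
    unfolding dx_min_def using that by (intro Min_le[OF fin]) (auto simp: interior_nodes_def)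
qed

theorem theorem4:
  fixes N :: "'v::finite \<Rightarrow> 'v set"
    and dx :: "'v \<Rightarrow> 'v \<Rightarrow> real"
    and H :: "'v \<Rightarrow> real \<Rightarrow> ('v \<Rightarrow> real) \<Rightarrow> real"
    and g :: "'v \<Rightarrow> real"
    and Hu Hp lam lam_b c1 c2 :: real
    and R :: "real ^ 'v \<Rightarrow> real ^ 'v"
    and L :: "real ^ 'v \<Rightarrow> real"
  assumes no_loops: "\<And>j. j \<notin> N j"
    and interior_nonempty: "interior_nodes N \<noteq> {}"
    and boundary_nonempty: "boundary_nodes N \<noteq> {}"
    and dx_pos: "\<And>j k. k \<in> N j \<Longrightarrow> dx j k > 0"
    and Hu_pos: "Hu > 0" and Hp_pos: "Hp > 0"
    and H1: "hamiltonian_lipschitz N H Hu Hp"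
    and H2: "hamiltonian_monotone N H"
    and lam_pos: "lam > 0"
    and H3: "hamiltonian_strictly_monotone N H lam"
    and lam_b_pos: "lam_b > 0"
    and lam_large: "lam > Hp / dx_min N dx *
          real (MAX j\<in>interior_nodes N. max (card (N j)) (card (in_neighbors N j)))"
    and lam_b_large: "lam_b > Hp / dx_min N dx *
          real (MAX j\<in>boundary_nodes N. card (in_neighbors N j))"
    and c1_eq: "c1 = min lam lam_b"
    and c2_eq: "c2 = min
          (lam - Hp / dx_min N dx * real (MAX j\<in>interior_nodes N. card (in_neighbors N j)))
          (lam_b - Hp / dx_min N dx * real (MAX j\<in>boundary_nodes N. card (in_neighbors N j)))"
    and R_eq: "R = residual N dx H g lam_b"
    and L_eq: "L = (\<lambda>u. (norm (R u))\<^sup>2)"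
  shows "c2 > 0 \<and>
    (\<forall>ubar. R ubar = 0 \<longrightarrow> (\<forall>u. (norm (u - ubar))\<^sup>2 \<le> 1 / (c1 * c2) * L u)) \<and>
    (\<forall>u. \<forall>w\<in>clarke_gradient L u. (norm w)\<^sup>2 \<ge> 4 * c1 * c2 * L u) \<and>
    (\<forall>u. \<forall>A\<in>generalized_jacobian R u. invertible A \<and>
        condition_number A \<le> (c1 * c2) powr (- 1 / 2) * max (Hu + 2 * lam) (2 * lam_b))"
proof -
  define C where "C = Hp / dx_min N dx"
  define mJ where "mJ = (MAX j\<in>interior_nodes N. card (in_neighbors N j))"
  define mB where "mB = (MAX j\<in>boundary_nodes N. card (in_neighbors N j))"
  define m where "m = (MAX j\<in>interior_nodes N. max (card (N j)) (card (in_neighbors N j)))"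
  have dx_min: "dx_min N dx > 0" "k \<in> N j \<Longrightarrow> dx_min N dx \<le> dx j k" for j k
    using dx_min_pos_le[OF interior_nonempty, of dx] dx_pos by blast+
  have C0: "C > 0" using Hp_pos dx_min(1) by (simp add: C_def)
  have C: "Hp / dx j k \<le> C" if "k \<in> N j" for j k
    unfolding C_def using dx_min(1) dx_min(2)[OF that] dx_pos[OF that] Hp_pos
    by (intro divide_left_mono) auto
  have le_m: "card (N j) \<le> m" "card (in_neighbors N j) \<le> m" "card (in_neighbors N j) \<le> mJ"
    if "j \<in> interior_nodes N" for j
  proof -
    have "max (card (N j)) (card (in_neighbors N j)) \<le> m"
      unfolding m_def using that by (intro Max_ge) auto
    then show "card (N j) \<le> m" "card (in_neighbors N j) \<le> m" by simp_all
    show "card (in_neighbors N j) \<le> mJ"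
      unfolding mJ_def using that by (intro Max_ge) auto
  qed
  have le_mB: "card (in_neighbors N j) \<le> mB" if "j \<in> boundary_nodes N" for j
    unfolding mB_def using that by (intro Max_ge) auto
  have scale: "C * real a \<le> C * real b" if "a \<le> b" for a b
    using that C0 by simp
  have "mJ \<le> m"
    unfolding mJ_def using interior_nonempty le_m(2) by simp
  then have lam_mJ: "C * real mJ < lam"
    using lam_large scale[of mJ m] unfolding C_def m_def by linarith
  have lam_b_mB: "C * real mB < lam_b"
    using lam_b_large by (simp add: C_def mB_def)
  have c2: "c2 = min (lam - C * real mJ) (lam_b - C * real mB)"
    using c2_eq by (simp add: C_def mJ_def mB_def)
  have c1_pos: "c1 > 0" and c2_pos: "c2 > 0"
    using c1_eq lam_pos lam_b_pos c2 lam_mJ lam_b_mB by simp_all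

  define mu where "mu = sqrt (c1 * c2)"
  have mu_pos: "mu > 0" and mu_sq: "mu\<^sup>2 = c1 * c2"
    using c1_pos c2_pos by (simp_all add: mu_def)
  \<comment> \<open>The estimates give the arithmetic mean of \<open>c1\<close> and \<open>c2\<close>; the claims use the geometric one.\<close>
  have mu_le: "mu \<le> (c1 + c2) / 2"
    unfolding mu_def using c1_pos c2_pos by (intro arith_geo_mean_sqrt) simp_all
  have mono: "strongly_monotone mu R"
    unfolding R_eq
  proof (rule strongly_monotone_residual[OF dx_pos H1 H2 H3 less_imp_le[OF Hp_pos] C])
    fix j
    show "mu \<le> (if j \<in> interior_nodes N then lam else lam_b) - C / 2 * real (card (in_neighbors N j))"
    proof (cases "j \<in> interior_nodes N")
      case True
      then show ?thesis
        using mu_le c1_eq c2 scale[OF le_m(3)[OF True]] by simp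
    next
      case False
      then have "j \<in> boundary_nodes N" by (simp add: interior_nodes_def boundary_nodes_def)
      from scale[OF le_mB[OF this]] show ?thesis
        using False mu_le c1_eq c2 by simp
    qed
  qed

  define M where "M = max (Hu + 2 * lam) (2 * lam_b)"
  have lip: "norm (R u - R v) \<le> M * norm (u - v)" for u v
    unfolding R_eq M_def
  proof (rule lipschitz_residual[OF dx_pos H1 _ _ C])
    show "C * real (card (N j)) \<le> lam \<and> C * real (card (in_neighbors N j)) \<le> lam"
      if "j \<in> interior_nodes N" for j
      using lam_large scale[OF le_m(1)[OF that]] scale[OF le_m(2)[OF that]]
      unfolding C_def m_def by linarith
    show "C * real (card (in_neighbors N j)) \<le> lam_b" if "j \<in> boundary_nodes N" for j
      using lam_b_mB scale[OF le_mB[OF that]] by linarith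
  qed (use Hu_pos Hp_pos C0 lam_b_pos in simp_all)
  have "M-lipschitz_on UNIV R"
    by (rule lipschitz_onI) (use lip lam_b_pos in \<open>auto simp: dist_norm M_def\<close>)
  then have cont: "continuous_on UNIV R"
    by (rule lipschitz_on_continuous_on)

  have error: "(norm (u - ubar))\<^sup>2 \<le> 1 / (c1 * c2) * L u" if "R ubar = 0" for u ubar
  proof -
    have "mu * norm (u - ubar) \<le> norm (R u)"
      using coercive_norm_le mono that unfolding strongly_monotone_def by (metis diff_zero)
    then have "(mu * norm (u - ubar))\<^sup>2 \<le> (norm (R u))\<^sup>2"
      using mu_pos by (intro power_mono) simp_all
    then show ?thesis
      using c1_pos c2_pos by (simp add: L_eq power_mult_distrib mu_sq field_simps)
  qed
  have pl: "(norm w)\<^sup>2 \<ge> 4 * c1 * c2 * L u" if "w \<in> clarke_gradient L u" for u w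
  proof -
    have "2 * mu * (norm (R u))\<^sup>2 \<le> R u \<bullet> w"
      using strongly_monotone_clarke_gradient_sq_norm[OF mono cont] that by (simp add: L_eq)
    then have "2 * mu * norm (R u) \<le> norm w"
      by (rule coercive_norm_le)
    then have "(2 * mu * norm (R u))\<^sup>2 \<le> (norm w)\<^sup>2"
      using mu_pos by (intro power_mono) simp_all
    then show ?thesis
      by (simp add: L_eq power_mult_distrib mu_sq mult.assoc)
  qed
  have cond: "invertible A \<and> condition_number A \<le> (c1 * c2) powr (- 1 / 2) * M"
    if "A \<in> generalized_jacobian R u" for u A
  proof -
    note A = condition_number_coercive_le[OF mu_pos
        strongly_monotone_generalized_jacobian[OF mono that]
        lipschitz_generalized_jacobian[OF lip that]]
    have "(c1 * c2) powr (- 1 / 2) = 1 / mu"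
      using c1_pos c2_pos by (simp add: mu_def powr_minus_divide powr_half_sqrt)
    with A show ?thesis by simp
  qed
  show ?thesis
    using c2_pos error pl cond by (auto simp: M_def)
qed

end
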